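(* Let $\phi : G \to H$ be an ordered functor of ordered groupoids. Then $\phi$ admits a factorization $$G \xrightarrow{\ i_\phi\ } M^{\phi} \xrightarrow{\ p_\phi\ } H,\qquad \phi=i_\phi p_\phi,$$ where $i_\phi : g \mapsto \langle (g\mathbf{d})\phi,\, g,\, (g\mathbf{r})\phi\rangle$ and $M^\phi$ is an enlargement of $Gi_\phi$, and where $p_\phi : \langle h_0,a,h_1\rangle \mapsto h_0^{-1}(a\phi)h_1$ is a strong fibration.
   Context: Conventions: a groupoid $G$ is a small category in which every morphism is invertible, identified with its set of arrows under partial composition; $G_0\subseteq G$ is its set of identities. An arrow $g$ has domain $g\mathbf{d}=gg^{-1}$ and range $g\mathbf{r}=g^{-1}g$, and $gh$ is defined iff $g\mathbf{r}=h\mathbf{d}$. Maps are written on the right and composed from left to right. An ordered groupoid is a groupoid $G$ with a partial order $\leq$ on arrows such that: (OG1) $g\leq h$ implies $g^{-1}\leq h^{-1}$; (OG2) if $g_1\leq g_2$, $h_1\leq h_2$ and $g_1h_1$, $g_2h_2$ are defined, then $g_1h_1\leq g_2h_2$; (OG3) if $g\in G$, $f\in G_0$ and $f\leq g\mathbf{d}$, there is a unique $(f|g)\leq g$ with domain $f$. Ordered functors (morphisms of ordered groupoids) are order-preserving functors. Products are ordered componentwise. $\mathscr{I}$ is the groupoid with two identities $0,1$ and two non-identity arrows $\iota,\iota^{-1}$, $\iota\mathbf{d}=0$, $\iota\mathbf{r}=1$, with the trivial order. An ordered functor $p:G\to H$ is a strong fibration if it has the ordered homotopy lifting property: for every ordered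 groupoid $A$ and all ordered functors $f:A\to G$ and $F:A\times\mathscr{I}\to H$ with $fp=i_0F$, where $i_0:A\to A\times\mathscr{I}$, $a\mapsto(a,0)$, there is an ordered functor $\widetilde{F}:A\times\mathscr{I}\to G$ with $i_0\widetilde{F}=f$ and $\widetilde{F}p=F$. An enlargement of ordered groupoids is an inclusion of a subgroupoid $A\hookrightarrow B$ (one says $B$ is an enlargement of $A$) such that $A_0$ is an order ideal in $B_0$; if $b\in B$ and $b\mathbf{d},b\mathbf{r}\in A$ then $b\in A$; and for every $e\in B_0$ there is $b\in B$ with $b\mathbf{d}=e$ and $b\mathbf{r}\in A_0$. The mapping cocylinder of $\phi:G\to H$ is the ordered groupoid $M^\phi=\{\langle h_0,a,h_1\rangle : a\in G,\ h_0,h_1\in H,\ h_0^{-1}(a\phi)h_1\text{ exists}\}$, with object set $\{(e,h)\in G_0\times H: e\phi=h\mathbf{d}\}$ (the object $(e,h)$ corresponding to the identity arrow $\langle h,e,h\rangle$), $\langle h_0,a,h_1\rangle\mathbf{d}=(a\mathbf{d},h_0)$, $\langle h_0,a,h_1\rangle\mathbf{r}=(a\mathbf{r},h_1)$, composition $\langle h_0,a,h_1\rangle\langle k_0,b,k_1\rangle=\langle h_0,ab,k_1\rangle$ when $(a\mathbf{r},h_1)=(b\mathbf{d},k_0)$, and the componentwise order. *)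

theory Defs
  imports Main
begin

text \<open>
  A groupoid is given by its set of arrows, its composition and its inversion.  Arrows compose
  from left to right.  Composition is a total HOL function, but its value \<open>g \<cdot> h\<close> is only
  meaningful when \<open>composable G g h\<close> holds; likewise inversion and the order matter only on
  arrows.  Inverses are determined by the composition, so carrying them in the record adds no
  structure.
\<close>

record 'a ord_groupoid =
  arr :: "'a set"
  mul :: "'a \<Rightarrow> 'a \<Rightarrow> 'a"  (infixl "\<cdot>\<index>" 70)
  ginv :: "'a \<Rightarrow> 'a"
  leq :: "'a \<Rightarrow> 'a \<Rightarrow> bool"  (infix "\<preceq>\<index>" 50)

definition dm :: "('a, 'm) ord_groupoid_scheme \<Rightarrow> 'a \<Rightarrow> 'a" where
  "dm G g = g \<cdot>\<^bsub>G\<^esub> ginv G g"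

definition rn :: "('a, 'm) ord_groupoid_scheme \<Rightarrow> 'a \<Rightarrow> 'a" where
  "rn G g = ginv G g \<cdot>\<^bsub>G\<^esub> g"

definition composable :: "('a, 'm) ord_groupoid_scheme \<Rightarrow> 'a \<Rightarrow> 'a \<Rightarrow> bool" where
  "composable G g h \<longleftrightarrow> g \<in> arr G \<and> h \<in> arr G \<and> rn G g = dm G h"

definition identities :: "('a, 'm) ord_groupoid_scheme \<Rightarrow> 'a set" where
  "identities G = {e \<in> arr G. dm G e = e}"

locale groupoid =
  fixes G :: "('a, 'm) ord_groupoid_scheme" (structure)
  assumes dm_closed: "g \<in> arr G \<Longrightarrow> dm G g \<in> arr G"
    and rn_closed: "g \<in> arr G \<Longrightarrow> rn G g \<in> arr G"
    and dm_dm: "g \<in> arr G \<Longrightarrow> dm G (dm G g) = dm G g"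
    and rn_dm: "g \<in> arr G \<Longrightarrow> rn G (dm G g) = dm G g"
    and dm_rn: "g \<in> arr G \<Longrightarrow> dm G (rn G g) = rn G g"
    and rn_rn: "g \<in> arr G \<Longrightarrow> rn G (rn G g) = rn G g"
    and mul_closed: "composable G g h \<Longrightarrow> g \<cdot> h \<in> arr G"
    and dm_mul: "composable G g h \<Longrightarrow> dm G (g \<cdot> h) = dm G g"
    and rn_mul: "composable G g h \<Longrightarrow> rn G (g \<cdot> h) = rn G h"
    and mul_assoc: "composable G g h \<Longrightarrow> composable G h k \<Longrightarrow> (g \<cdot> h) \<cdot> k = g \<cdot> (h \<cdot> k)"
    and dm_mul_self: "g \<in> arr G \<Longrightarrow> dm G g \<cdot> g = g"
    and mul_rn_self: "g \<in> arr G \<Longrightarrow> g \<cdot> rn G g = g"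
    and ginv_closed: "g \<in> arr G \<Longrightarrow> ginv G g \<in> arr G"
    and dm_ginv: "g \<in> arr G \<Longrightarrow> dm G (ginv G g) = rn G g"
    and rn_ginv: "g \<in> arr G \<Longrightarrow> rn G (ginv G g) = dm G g"

locale ordered_groupoid = groupoid G
  for G :: "('a, 'm) ord_groupoid_scheme" (structure) +
  assumes leq_refl: "reflp_on (arr G) (leq G)"
    and leq_trans: "transp_on (arr G) (leq G)"
    and leq_antisym: "antisymp_on (arr G) (leq G)"
    and OG1: "g \<in> arr G \<Longrightarrow> h \<in> arr G \<Longrightarrow> g \<preceq> h \<Longrightarrow> ginv G g \<preceq> ginv G h"
    and OG2: "composable G g1 h1 \<Longrightarrow> composable G g2 h2 \<Longrightarrow> g1 \<preceq> g2 \<Longrightarrow> h1 \<preceq> h2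
      \<Longrightarrow> g1 \<cdot> h1 \<preceq> g2 \<cdot> h2"
    and OG3: "g \<in> arr G \<Longrightarrow> f \<in> identities G \<Longrightarrow> f \<preceq> dm G g
      \<Longrightarrow> \<exists>!k. k \<in> arr G \<and> k \<preceq> g \<and> dm G k = f"

definition ordered_functor ::
  "('a, 'm) ord_groupoid_scheme \<Rightarrow> ('b, 'n) ord_groupoid_scheme \<Rightarrow> ('a \<Rightarrow> 'b) \<Rightarrow> bool" where
  "ordered_functor G H f \<longleftrightarrow>
     (\<forall>g\<in>arr G. f g \<in> arr H \<and> f (dm G g) = dm H (f g) \<and> f (rn G g) = rn H (f g)) \<and>
     (\<forall>g h. composable G g h \<longrightarrow> f (g \<cdot>\<^bsub>G\<^esub> h) = f g \<cdot>\<^bsub>H\<^esub> f h) \<and>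
     (\<forall>g\<in>arr G. \<forall>h\<in>arr G. g \<preceq>\<^bsub>G\<^esub> h \<longrightarrow> f g \<preceq>\<^bsub>H\<^esub> f h)"

definition prod_groupoid :: "'a ord_groupoid \<Rightarrow> 'b ord_groupoid \<Rightarrow> ('a \<times> 'b) ord_groupoid" where
  "prod_groupoid A B = \<lparr>
     arr = arr A \<times> arr B,
     mul = (\<lambda>(a, b) (a', b'). (a \<cdot>\<^bsub>A\<^esub> a', b \<cdot>\<^bsub>B\<^esub> b')),
     ginv = (\<lambda>(a, b). (ginv A a, ginv B b)),
     leq = (\<lambda>(a, b) (a', b'). a \<preceq>\<^bsub>A\<^esub> a' \<and> b \<preceq>\<^bsub>B\<^esub> b')\<rparr>"

datatype interval = I0 | I1 | Iota | IotaInv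

text \<open>Only the eight composable pairs are specified.\<close>

fun interval_mul :: "interval \<Rightarrow> interval \<Rightarrow> interval" where
  "interval_mul I0 I0 = I0"
| "interval_mul I0 Iota = Iota"
| "interval_mul Iota I1 = Iota"
| "interval_mul Iota IotaInv = I0"
| "interval_mul I1 I1 = I1"
| "interval_mul I1 IotaInv = IotaInv"
| "interval_mul IotaInv I0 = IotaInv"
| "interval_mul IotaInv Iota = I1"

fun interval_inv :: "interval \<Rightarrow> interval" where
  "interval_inv I0 = I0"
| "interval_inv I1 = I1"
| "interval_inv Iota = IotaInv"
| "interval_inv IotaInv = Iota"

definition interval_groupoid :: "interval ord_groupoid" where
  "interval_groupoid = \<lparr>arr = UNIV, mul = interval_mul, ginv = interval_inv, leq = (=)\<rparr>"

text \<open>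
  The ordered homotopy lifting property quantifies over all ordered groupoids \<open>A\<close>.  HOL cannot
  quantify over types inside a formula, so the type of arrows of \<open>A\<close> is a parameter; a theorem
  asserting \<open>strong_fibration TYPE('c) G H p\<close> with \<open>'c\<close> a type variable asserts it for every type.
\<close>

definition strong_fibration ::
  "'c itself \<Rightarrow> 'a ord_groupoid \<Rightarrow> 'b ord_groupoid \<Rightarrow> ('a \<Rightarrow> 'b) \<Rightarrow> bool" where
  "strong_fibration T G H p \<longleftrightarrow>
     ordered_groupoid G \<and> ordered_groupoid H \<and> ordered_functor G H p \<and>
     (\<forall>(A :: 'c ord_groupoid) f F.
        ordered_groupoid A \<and> ordered_functor A G f \<and>
        ordered_functor (prod_groupoid A interval_groupoid) H F \<and>
        (\<forall>a\<in>arr A. p (f a) = F (a, I0)) \<longrightarrow>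
        (\<exists>F'. ordered_functor (prod_groupoid A interval_groupoid) G F' \<and>
              (\<forall>a\<in>arr A. F' (a, I0) = f a) \<and>
              (\<forall>x\<in>arr (prod_groupoid A interval_groupoid). p (F' x) = F x)))"

text \<open>
  \<open>enlargement S B\<close>: the ordered groupoid \<open>B\<close> is an enlargement of its subgroupoid with arrow
  set \<open>S\<close>, taken with the operations and the order of \<open>B\<close>.
\<close>

definition enlargement :: "'a set \<Rightarrow> 'a ord_groupoid \<Rightarrow> bool" where
  "enlargement S B \<longleftrightarrow> (let A = B\<lparr>arr := S\<rparr> in
     ordered_groupoid B \<and> S \<subseteq> arr B \<and> ordered_groupoid A \<and>
     (\<forall>e\<in>identities A. \<forall>f\<in>identities B. f \<preceq>\<^bsub>B\<^esub> e \<longrightarrow> f \<in> identities A) \<and>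
     (\<forall>b\<in>arr B. dm B b \<in> S \<and> rn B b \<in> S \<longrightarrow> b \<in> S) \<and>
     (\<forall>e\<in>identities B. \<exists>b\<in>arr B. dm B b = e \<and> rn B b \<in> identities A))"

text \<open>
  The arrow \<open>\<langle>h0, a, h1\<rangle>\<close> is the triple \<open>(h0, a, h1)\<close>.  Its domain is the identity
  \<open>(h0, dm G a, h0)\<close>, which represents the object \<open>(dm G a, h0)\<close>; similarly for its range.
\<close>

definition mapping_cocylinder ::
  "'a ord_groupoid \<Rightarrow> 'b ord_groupoid \<Rightarrow> ('a \<Rightarrow> 'b) \<Rightarrow> ('b \<times> 'a \<times> 'b) ord_groupoid" where
  "mapping_cocylinder G H \<phi> = \<lparr>
     arr = {(h0, a, h1). a \<in> arr G \<and> h0 \<in> arr H \<and> h1 \<in> arr H \<and>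
              composable H (ginv H h0) (\<phi> a) \<and>
              composable H (ginv H h0 \<cdot>\<^bsub>H\<^esub> \<phi> a) h1},
     mul = (\<lambda>(h0, a, h1) (k0, b, k1). (h0, a \<cdot>\<^bsub>G\<^esub> b, k1)),
     ginv = (\<lambda>(h0, a, h1). (h1, ginv G a, h0)),
     leq = (\<lambda>(h0, a, h1) (k0, b, k1). h0 \<preceq>\<^bsub>H\<^esub> k0 \<and> a \<preceq>\<^bsub>G\<^esub> b \<and> h1 \<preceq>\<^bsub>H\<^esub> k1)\<rparr>"

definition cocyl_incl ::
  "'a ord_groupoid \<Rightarrow> ('a \<Rightarrow> 'b) \<Rightarrow> 'a \<Rightarrow> 'b \<times> 'a \<times> 'b" where
  "cocyl_incl G \<phi> g = (\<phi> (dm G g), g, \<phi> (rn G g))"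

definition cocyl_proj ::
  "'b ord_groupoid \<Rightarrow> ('a \<Rightarrow> 'b) \<Rightarrow> 'b \<times> 'a \<times> 'b \<Rightarrow> 'b" where
  "cocyl_proj H \<phi> = (\<lambda>(h0, a, h1). ginv H h0 \<cdot>\<^bsub>H\<^esub> \<phi> a \<cdot>\<^bsub>H\<^esub> h1)"

end

theory Submission imports Defs begin

text \<open>
  An object of the mapping cocylinder \<open>M\<close> is an object \<open>e\<close> of \<open>G\<close> together with an arrow \<open>h\<close> of
  \<open>H\<close>, its leg, that starts at \<open>e\<phi>\<close>.  An arrow of \<open>M\<close> is an arrow of \<open>G\<close> together with a leg
  at each of its two ends.  So the groupoid structure of \<open>M\<close> is that of \<open>G\<close> with legs carried
  along.  Restricting an arrow of \<open>M\<close> means restricting its component in \<open>G\<close>; one end of the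
  result has a prescribed leg, and the other leg is then forced, since it must be the restriction
  of the old one to the new endpoint (\<open>restriction_M\<close>).

  The projection reads an arrow of \<open>M\<close> as a journey from the far end of one leg to the far end of
  the other, by way of \<open>\<phi>\<close>.  In a composite the leg at the middle object is traversed
  in both directions and cancels, which gives functoriality (\<open>proj_mul\<close>).

  The image of \<open>G\<close> is the full subgroupoid on the objects whose leg is an identity.  Such objects
  form an order ideal because everything below an identity is an identity
  (\<open>image_incl_ideal\<close>), and every object is joined to one of them by shrinking its leg
  (\<open>enlargement_M\<close>).

  To lift a homotopy \<open>F\<close> that starts at the projection of \<open>f\<close>, lengthen the legs.  At an
  object \<open>e\<close> of the parameter groupoid the leg of \<open>f e\<close> ends where the path \<open>F (e, -)\<close> begins, and
  the lift appends this path to the leg while leaving the component in \<open>G\<close> alone.  The new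
  legs are products in \<open>H\<close> of order-preserving functions, so the lift preserves the order.  It
  projects to \<open>F\<close> because every arrow \<open>t\<close> of the interval is the path from its domain back to
  \<open>I0\<close> followed by the path from \<open>I0\<close> to its range (\<open>proj_lift\<close>).
\<close>

section \<open>Inverses and restrictions in ordered groupoids\<close>

context groupoid
begin

lemma composable_ginv:
  assumes "g \<in> arr G"
  shows "composable G g (ginv G g)" "composable G (ginv G g) g"
  using assms by (simp_all add: composable_def dm_ginv rn_ginv ginv_closed)

lemma mul_ginv: "g \<cdot> ginv G g = dm G g"
  by (simp add: dm_def)

lemma ginv_mul_cancel:
  assumes "composable G g k"
  shows "ginv G g \<cdot> (g \<cdot> k) = k"
proof -
  have "ginv G g \<cdot> (g \<cdot> k) = (ginv G g \<cdot> g) \<cdot> k"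
    using assms by (subst mul_assoc) (auto simp: composable_def rn_ginv ginv_closed)
  also have "\<dots> = dm G k \<cdot> k"
    using assms by (simp add: composable_def rn_def)
  also have "\<dots> = k" using assms by (simp add: composable_def dm_mul_self)
  finally show ?thesis .
qed

lemma ginv_unique:
  assumes "composable G g k" "g \<cdot> k = dm G g"
  shows "k = ginv G g"
proof -
  have g: "g \<in> arr G" using assms(1) by (simp add: composable_def)
  have "k = ginv G g \<cdot> dm G g"
    using ginv_mul_cancel[OF assms(1)] assms(2) by simp
  also have "\<dots> = ginv G g"
    using mul_rn_self[OF ginv_closed[OF g]] g by (simp add: rn_ginv)
  finally show ?thesis .
qed

lemma ginv_ginv:
  assumes "g \<in> arr G" shows "ginv G (ginv G g) = g"
  by (rule ginv_unique[symmetric, OF composable_ginv(2)[OF assms]])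
     (simp add: dm_ginv[OF assms] rn_def)

lemma ginv_dm:
  assumes "g \<in> arr G" shows "ginv G (dm G g) = dm G g"
proof (rule ginv_unique[symmetric])
  show "composable G (dm G g) (dm G g)"
    using assms by (simp add: composable_def dm_closed rn_dm dm_dm)
  show "dm G g \<cdot> dm G g = dm G (dm G g)"
    using dm_mul_self[OF dm_closed[OF assms]] assms by (simp add: dm_dm)
qed

lemma ginv_mul:
  assumes c: "composable G g h"
  shows "ginv G (g \<cdot> h) = ginv G h \<cdot> ginv G g"
proof -
  have gh: "g \<in> arr G" "h \<in> arr G" "rn G g = dm G h" using c by (auto simp: composable_def)
  have c1: "composable G (ginv G h) (ginv G g)"
    using gh by (simp add: composable_def ginv_closed dm_ginv rn_ginv)
  have c2: "composable G h (ginv G h \<cdot> ginv G g)"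
    using gh c1 by (simp add: composable_def mul_closed dm_mul dm_ginv)
  have "(g \<cdot> h) \<cdot> (ginv G h \<cdot> ginv G g) = g \<cdot> (h \<cdot> (ginv G h \<cdot> ginv G g))"
    using c c2 by (rule mul_assoc)
  also have "h \<cdot> (ginv G h \<cdot> ginv G g) = ginv G g"
    using ginv_mul_cancel[OF c1] gh by (simp add: ginv_ginv)
  finally have e: "(g \<cdot> h) \<cdot> (ginv G h \<cdot> ginv G g) = dm G (g \<cdot> h)"
    by (simp add: mul_ginv dm_mul[OF c])
  have "composable G (g \<cdot> h) (ginv G h \<cdot> ginv G g)"
    using c c1 gh by (simp add: composable_def mul_closed rn_mul dm_mul dm_ginv)
  from ginv_unique[OF this e] show ?thesis by simp
qed

end

context ordered_groupoid
begin

lemma leq_reflD: "g \<in> arr G \<Longrightarrow> g \<preceq> g"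
  using leq_refl by (simp add: reflp_on_def)

lemma leq_transD: "\<lbrakk>g \<preceq> h; h \<preceq> k; g \<in> arr G; h \<in> arr G; k \<in> arr G\<rbrakk> \<Longrightarrow> g \<preceq> k"
  using leq_trans by (meson transp_onD)

lemma leq_antisymD: "\<lbrakk>g \<preceq> h; h \<preceq> g; g \<in> arr G; h \<in> arr G\<rbrakk> \<Longrightarrow> g = h"
  using leq_antisym by (meson antisymp_onD)

lemma dm_mono:
  assumes "g \<in> arr G" "h \<in> arr G" "g \<preceq> h" shows "dm G g \<preceq> dm G h"
  unfolding dm_def using assms by (intro OG2 OG1 composable_ginv)

lemma rn_mono:
  assumes "g \<in> arr G" "h \<in> arr G" "g \<preceq> h" shows "rn G g \<preceq> rn G h"
  unfolding rn_def using assms by (intro OG2 OG1 composable_ginv)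

lemma dm_in_identities: "g \<in> arr G \<Longrightarrow> dm G g \<in> identities G"
  by (simp add: identities_def dm_closed dm_dm)

lemma rn_in_identities: "g \<in> arr G \<Longrightarrow> rn G g \<in> identities G"
  by (simp add: identities_def rn_closed dm_rn)

lemma restriction_unique:
  assumes "g \<in> arr G" "k \<in> arr G" "k' \<in> arr G" "k \<preceq> g" "k' \<preceq> g" "dm G k = dm G k'"
  shows "k = k'"
proof -
  have "dm G k \<preceq> dm G g" using assms by (intro dm_mono)
  from OG3[OF assms(1) dm_in_identities[OF assms(2)] this] show ?thesis
    using assms by metis
qed

text \<open>Both \<open>k\<close> and its domain are restrictions of \<open>e\<close> to the domain of \<open>k\<close>.\<close>

lemma below_identity:
  assumes "k \<in> arr G" "e \<in> identities G" "k \<preceq> e"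
  shows "dm G k = k"
proof (rule restriction_unique)
  show "e \<in> arr G" "k \<in> arr G" "dm G k \<in> arr G" "k \<preceq> e"
    using assms by (auto simp: identities_def dm_closed)
  show "dm G k \<preceq> e" using dm_mono[of k e] assms by (simp add: identities_def)
  show "dm G (dm G k) = dm G k" using assms by (simp add: dm_dm)
qed

text \<open>
  Only the existence of restrictions needs an argument.  If \<open>g\<close> joins two identities of the order
  ideal \<open>E\<close>, then the range of a restriction of \<open>g\<close> lies below the range of \<open>g\<close>, so it is in \<open>E\<close>
  again, and fullness puts the restriction into \<open>S\<close>.
\<close>

lemma full_subgroupoid_on_ideal:
  assumes S: "\<And>g. g \<in> S \<longleftrightarrow> g \<in> arr G \<and> dm G g \<in> E \<and> rn G g \<in> E"
    and ideal: "\<And>e f. \<lbrakk>e \<in> E; e \<in> identities G; f \<in> identities G; f \<preceq> e\<rbrakk> \<Longrightarrow> f \<in> E"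
  shows "ordered_groupoid (G\<lparr>arr := S\<rparr>)"
proof -
  let ?A = "G\<lparr>arr := S\<rparr>"
  have [simp]: "dm ?A = dm G" "rn ?A = rn G" by (auto simp: dm_def rn_def)
  have comp: "composable ?A g h \<longleftrightarrow> g \<in> S \<and> h \<in> S \<and> composable G g h" for g h
    using S by (auto simp: composable_def)
  have gpd: "groupoid ?A"
    by unfold_locales
      (auto simp: comp S dm_closed rn_closed dm_dm rn_dm dm_rn rn_rn mul_closed dm_mul rn_mul
        mul_assoc dm_mul_self mul_rn_self ginv_closed dm_ginv rn_ginv)
  have SG: "S \<subseteq> arr G" using S by auto
  have restr: "\<exists>!k. k \<in> S \<and> k \<preceq> g \<and> dm G k = f"
    if g: "g \<in> S" and f: "f \<in> identities ?A" "f \<preceq> dm G g" for g f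
  proof -
    have f': "f \<in> identities G" "f \<in> E" using f S by (auto simp: identities_def)
    have gG: "g \<in> arr G" using g SG by auto
    obtain k where k: "k \<in> arr G" "k \<preceq> g" "dm G k = f"
      using OG3[OF gG f'(1) f(2)] by auto
    have "rn G k \<in> E"
    proof (rule ideal)
      show "rn G g \<in> E" using g S by simp
      show "rn G k \<preceq> rn G g" using k gG by (intro rn_mono)
    qed (use k gG in \<open>auto intro: rn_in_identities\<close>)
    then have "k \<in> S" using S k f' by simp
    then show ?thesis using k restriction_unique[OF gG] SG by blast
  qed
  have "reflp_on S (leq G)" "transp_on S (leq G)" "antisymp_on S (leq G)"
    using leq_refl leq_trans leq_antisym SG
    by (auto intro: reflp_on_subset transp_on_subset antisymp_on_subset)
  then show ?thesis
    using gpd SG restr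
    by (auto simp: ordered_groupoid_def ordered_groupoid_axioms_def comp intro: OG1 OG2)
qed

end

section \<open>Ordered functors\<close>

lemma ordered_functorD:
  assumes "ordered_functor G H f"
  shows "g \<in> arr G \<Longrightarrow> f g \<in> arr H"
    and "g \<in> arr G \<Longrightarrow> f (dm G g) = dm H (f g)"
    and "g \<in> arr G \<Longrightarrow> f (rn G g) = rn H (f g)"
    and "composable G g h \<Longrightarrow> f (g \<cdot>\<^bsub>G\<^esub> h) = f g \<cdot>\<^bsub>H\<^esub> f h"
    and "g \<in> arr G \<Longrightarrow> h \<in> arr G \<Longrightarrow> g \<preceq>\<^bsub>G\<^esub> h \<Longrightarrow> f g \<preceq>\<^bsub>H\<^esub> f h"
  using assms by (auto simp: ordered_functor_def)

lemma ordered_functor_composable: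
  assumes "ordered_functor G H f" "composable G g h"
  shows "composable H (f g) (f h)"
  using assms by (auto simp: composable_def ordered_functorD(1)
      ordered_functorD(2,3)[OF assms(1), symmetric])

lemma ordered_functor_ginv:
  assumes "groupoid G" "groupoid H" "ordered_functor G H f" "g \<in> arr G"
  shows "f (ginv G g) = ginv H (f g)"
proof -
  interpret G: groupoid G by fact
  interpret H: groupoid H by fact
  have c: "composable G g (ginv G g)" using assms(4) by (rule G.composable_ginv)
  show ?thesis
  proof (rule H.ginv_unique)
    show "composable H (f g) (f (ginv G g))"
      by (rule ordered_functor_composable[OF assms(3) c])
    show "f g \<cdot>\<^bsub>H\<^esub> f (ginv G g) = dm H (f g)"
      using ordered_functorD(2,4)[OF assms(3)] c assms(4) by (metis G.mul_ginv)
  qed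
qed

section \<open>The mapping cocylinder\<close>

locale cocylinder = G: ordered_groupoid G + H: ordered_groupoid H
  for G :: "'a ord_groupoid" and H :: "'b ord_groupoid" +
  fixes \<phi> :: "'a \<Rightarrow> 'b"
  assumes ord_functor_\<phi>: "ordered_functor G H \<phi>"
begin

abbreviation M where "M \<equiv> mapping_cocylinder G H \<phi>"

lemmas \<phi>_closed = ordered_functorD(1)[OF ord_functor_\<phi>]
  and \<phi>_dm = ordered_functorD(2)[OF ord_functor_\<phi>]
  and \<phi>_rn = ordered_functorD(3)[OF ord_functor_\<phi>]
  and \<phi>_mul = ordered_functorD(4)[OF ord_functor_\<phi>]
  and \<phi>_mono = ordered_functorD(5)[OF ord_functor_\<phi>]

text \<open>
  The existence of \<open>h0\<^sup>-\<^sup>1 (a\<phi>) h1\<close> only says that \<open>h0\<close> and \<open>h1\<close> start at the two ends of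
  \<open>a\<phi>\<close>.  In this form the groupoid axioms of the cocylinder reduce to those of \<open>G\<close>.
\<close>

lemma arr_M:
  "(h0, a, h1) \<in> arr M \<longleftrightarrow> a \<in> arr G \<and> h0 \<in> arr H \<and> h1 \<in> arr H \<and>
     dm H h0 = \<phi> (dm G a) \<and> dm H h1 = \<phi> (rn G a)"
  by (auto simp: mapping_cocylinder_def composable_def H.ginv_closed H.rn_ginv H.mul_closed
      H.rn_mul \<phi>_closed \<phi>_dm \<phi>_rn)

lemma mul_M: "(h0, a, h1) \<cdot>\<^bsub>M\<^esub> (k0, b, k1) = (h0, a \<cdot>\<^bsub>G\<^esub> b, k1)"
  by (simp add: mapping_cocylinder_def)

lemma ginv_M: "ginv M (h0, a, h1) = (h1, ginv G a, h0)"
  by (simp add: mapping_cocylinder_def)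

lemma leq_M:
  "(h0, a, h1) \<preceq>\<^bsub>M\<^esub> (k0, b, k1) \<longleftrightarrow> h0 \<preceq>\<^bsub>H\<^esub> k0 \<and> a \<preceq>\<^bsub>G\<^esub> b \<and> h1 \<preceq>\<^bsub>H\<^esub> k1"
  by (simp add: mapping_cocylinder_def)

lemma dm_M: "dm M (h0, a, h1) = (h0, dm G a, h0)"
  by (simp add: dm_def mul_M ginv_M)

lemma rn_M: "rn M (h0, a, h1) = (h1, rn G a, h1)"
  by (simp add: rn_def mul_M ginv_M)

lemma composable_M:
  "composable M (h0, a, h1) (k0, b, k1) \<longleftrightarrow>
     (h0, a, h1) \<in> arr M \<and> (k0, b, k1) \<in> arr M \<and> h1 = k0 \<and> composable G a b"
  by (auto simp: composable_def dm_M rn_M arr_M)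

lemmas M_simps = arr_M mul_M ginv_M leq_M dm_M rn_M composable_M

lemma groupoid_M: "groupoid M"
proof
qed (auto simp: M_simps G.dm_closed G.rn_closed G.dm_dm G.rn_dm G.dm_rn G.rn_rn G.mul_closed
      G.dm_mul G.rn_mul G.mul_assoc G.dm_mul_self G.mul_rn_self G.ginv_closed G.dm_ginv
      G.rn_ginv)

text \<open>
  The restriction of \<open>(h0, a, h1)\<close> to the identity at \<open>(e, k)\<close> is \<open>(k, b, k1)\<close>, where \<open>b\<close> is
  the restriction of \<open>a\<close> to \<open>e\<close>, and \<open>k1\<close> must start at the \<open>\<phi>\<close>-image of the range of \<open>b\<close>,
  hence is the restriction of \<open>h1\<close> to that image.
\<close>

lemma restriction_M:
  assumes g: "g \<in> arr M" and f: "f \<in> identities M" "f \<preceq>\<^bsub>M\<^esub> dm M g"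
  shows "\<exists>!k. k \<in> arr M \<and> k \<preceq>\<^bsub>M\<^esub> g \<and> dm M k = f"
proof -
  obtain h0 a h1 where g_eq: "g = (h0, a, h1)" by (cases g)
  obtain k e k' where f_eq: "f = (k, e, k')" by (cases f)
  have a: "a \<in> arr G" "h0 \<in> arr H" "h1 \<in> arr H" "dm H h0 = \<phi> (dm G a)" "dm H h1 = \<phi> (rn G a)"
    using g by (auto simp: g_eq arr_M)
  have e: "k' = k" "e \<in> identities G" "k \<in> arr H" "dm H k = \<phi> e" "k \<preceq>\<^bsub>H\<^esub> h0"
      "e \<preceq>\<^bsub>G\<^esub> dm G a"
    using f by (auto simp: f_eq g_eq identities_def M_simps)
  obtain b where b: "b \<in> arr G" "b \<preceq>\<^bsub>G\<^esub> a" "dm G b = e"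
    using G.OG3[OF a(1) e(2,6)] by auto
  have rb: "rn G b \<preceq>\<^bsub>G\<^esub> rn G a" using b a by (intro G.rn_mono)
  have "\<phi> (rn G b) \<preceq>\<^bsub>H\<^esub> dm H h1"
    unfolding a(5) using rb a b by (intro \<phi>_mono G.rn_closed)
  moreover have "\<phi> (rn G b) \<in> identities H"
    using b by (simp add: \<phi>_rn H.rn_in_identities \<phi>_closed)
  ultimately obtain k1 where k1: "k1 \<in> arr H" "k1 \<preceq>\<^bsub>H\<^esub> h1" "dm H k1 = \<phi> (rn G b)"
    using H.OG3[OF a(3)] by blast
  show ?thesis
  proof (rule ex1I[of _ "(k, b, k1)"])
    show "(k, b, k1) \<in> arr M \<and> (k, b, k1) \<preceq>\<^bsub>M\<^esub> g \<and> dm M (k, b, k1) = f"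
      using b k1 e by (simp add: M_simps f_eq g_eq)
  next
    fix x assume x: "x \<in> arr M \<and> x \<preceq>\<^bsub>M\<^esub> g \<and> dm M x = f"
    obtain l0 c l1 where x_eq: "x = (l0, c, l1)" by (cases x)
    have c: "l0 = k" "c \<in> arr G" "c \<preceq>\<^bsub>G\<^esub> a" "dm G c = e" "l1 \<in> arr H" "l1 \<preceq>\<^bsub>H\<^esub> h1"
        "dm H l1 = \<phi> (rn G c)"
      using x by (auto simp: x_eq f_eq g_eq M_simps)
    have cb: "c = b" using G.restriction_unique[OF a(1) c(2) b(1)] b c by simp
    have "l1 = k1" using H.restriction_unique[OF a(3) c(5) k1(1)] k1 c cb by simp
    with cb c(1) show "x = (k, b, k1)" by (simp add: x_eq)
  qed
qed

lemma ordered_groupoid_M: "ordered_groupoid M"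
proof -
  have "reflp_on (arr M) (leq M)"
    by (auto simp: reflp_on_def M_simps G.leq_reflD H.leq_reflD)
  moreover have "transp_on (arr M) (leq M)"
    by (rule transp_onI) (auto simp: M_simps intro: G.leq_transD H.leq_transD)
  moreover have "antisymp_on (arr M) (leq M)"
    by (rule antisymp_onI) (auto simp: M_simps intro: G.leq_antisymD H.leq_antisymD)
  ultimately show ?thesis
    using groupoid_M restriction_M
    by (auto simp: ordered_groupoid_def ordered_groupoid_axioms_def M_simps
        intro: G.OG1 G.OG2)
qed

section \<open>The inclusion and the enlargement\<close>

lemma ordered_functor_incl: "ordered_functor G M (cocyl_incl G \<phi>)"
  by (auto simp: ordered_functor_def cocyl_incl_def M_simps composable_def G.dm_closed G.rn_closed
      G.dm_dm G.rn_dm G.dm_rn G.rn_rn G.dm_mul G.rn_mul \<phi>_closed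
      \<phi>_dm[symmetric] \<phi>_rn[symmetric] intro: \<phi>_mono G.dm_mono G.rn_mono)

lemma mem_image_incl:
  "(h0, a, h1) \<in> cocyl_incl G \<phi> ` arr G \<longleftrightarrow>
     a \<in> arr G \<and> h0 = \<phi> (dm G a) \<and> h1 = \<phi> (rn G a)"
  by (auto simp: cocyl_incl_def)

lemma image_incl_full:
  "g \<in> cocyl_incl G \<phi> ` arr G \<longleftrightarrow>
     g \<in> arr M \<and> dm M g \<in> cocyl_incl G \<phi> ` arr G \<and> rn M g \<in> cocyl_incl G \<phi> ` arr G"
  by (cases g) (auto simp: mem_image_incl M_simps G.dm_closed G.rn_closed G.dm_dm G.rn_dm
      G.dm_rn G.rn_rn \<phi>_closed \<phi>_dm[symmetric] \<phi>_rn[symmetric])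

text \<open>An object \<open>(e', k)\<close> below \<open>(e, e\<phi>)\<close> has \<open>k\<close> below an identity, so \<open>k\<close> is an
  identity, namely its own domain \<open>e'\<phi>\<close>.\<close>

lemma image_incl_ideal:
  assumes e: "e \<in> cocyl_incl G \<phi> ` arr G" "e \<in> identities M"
    and f: "f \<in> identities M" "f \<preceq>\<^bsub>M\<^esub> e"
  shows "f \<in> cocyl_incl G \<phi> ` arr G"
proof -
  obtain h a h' where e_eq: "e = (h, a, h')" by (cases e)
  obtain k b k' where f_eq: "f = (k, b, k')" by (cases f)
  have a: "a \<in> arr G" "h = \<phi> (dm G a)"
    using e(1) by (auto simp: e_eq mem_image_incl)
  have b: "k' = k" "b \<in> arr G" "dm G b = b" "k \<in> arr H" "dm H k = \<phi> b" "k \<preceq>\<^bsub>H\<^esub> h"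
    using f by (auto simp: f_eq e_eq identities_def M_simps)
  have "h \<in> identities H" using a by (simp add: \<phi>_dm \<phi>_closed H.dm_in_identities)
  then have "dm H k = k" using H.below_identity b by blast
  then have k: "k = \<phi> b" using b by simp
  have "rn G b = b" using G.rn_dm[OF b(2)] b(3) by simp
  then show ?thesis using b k by (simp add: f_eq mem_image_incl)
qed

text \<open>Every object \<open>(e, h)\<close> is joined to \<open>(e, e\<phi>)\<close> by the arrow \<open>(h, e, e\<phi>)\<close>.\<close>

lemma enlargement_M: "enlargement (cocyl_incl G \<phi> ` arr G) M"
proof -
  let ?S = "cocyl_incl G \<phi> ` arr G"
  interpret M: ordered_groupoid M by (rule ordered_groupoid_M)
  have S_M: "?S \<subseteq> arr M"
    using image_incl_full by blast
  then have ids: "identities (M\<lparr>arr := ?S\<rparr>) = identities M \<inter> ?S"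
    by (auto simp: identities_def dm_def)
  have join: "\<exists>b\<in>arr M. dm M b = e \<and> rn M b \<in> identities M \<inter> ?S"
    if e: "e \<in> identities M" for e
  proof -
    obtain h a h' where e_eq: "e = (h, a, h')" by (cases e)
    have a: "h' = h" "a \<in> arr G" "dm G a = a" "h \<in> arr H" "dm H h = \<phi> a"
      using e by (auto simp: e_eq identities_def M_simps)
    have ra: "rn G a = a" using G.rn_dm[OF a(2)] a(3) by simp
    let ?b = "(h, a, \<phi> a)"
    have b: "?b \<in> arr M" using a ra by (simp add: arr_M \<phi>_closed \<phi>_dm[symmetric])
    moreover have "dm M ?b = e" using a by (simp add: dm_M e_eq)
    moreover have "rn M ?b \<in> ?S" using a ra by (simp add: rn_M mem_image_incl)
    ultimately show ?thesis using M.rn_in_identities by blast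
  qed
  show ?thesis
    unfolding enlargement_def Let_def ids
  proof (intro conjI)
    show "ordered_groupoid (M\<lparr>arr := ?S\<rparr>)"
      by (rule M.full_subgroupoid_on_ideal[OF image_incl_full image_incl_ideal])
    show "\<forall>e\<in>identities M \<inter> ?S. \<forall>f\<in>identities M. f \<preceq>\<^bsub>M\<^esub> e \<longrightarrow> f \<in> identities M \<inter> ?S"
      using image_incl_ideal by blast
    show "\<forall>b\<in>arr M. dm M b \<in> ?S \<and> rn M b \<in> ?S \<longrightarrow> b \<in> ?S"
      by (intro ballI impI, subst image_incl_full) simp
    show "\<forall>e\<in>identities M. \<exists>b\<in>arr M. dm M b = e \<and> rn M b \<in> identities M \<inter> ?S"
      using join by blast
  qed (rule ordered_groupoid_M S_M)+
qed

section \<open>The projection\<close>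

lemma proj_eq: "cocyl_proj H \<phi> (h0, a, h1) = ginv H h0 \<cdot>\<^bsub>H\<^esub> \<phi> a \<cdot>\<^bsub>H\<^esub> h1"
  by (simp add: cocyl_proj_def)

lemma proj_composable:
  assumes "(h0, a, h1) \<in> arr M"
  shows "composable H (ginv H h0) (\<phi> a)" "composable H (\<phi> a) h1"
    "composable H (ginv H h0 \<cdot>\<^bsub>H\<^esub> \<phi> a) h1" "composable H (ginv H h0) (\<phi> a \<cdot>\<^bsub>H\<^esub> h1)"
proof -
  show 1: "composable H (ginv H h0) (\<phi> a)" and 2: "composable H (\<phi> a) h1"
    using assms by (simp_all add: arr_M composable_def H.ginv_closed H.rn_ginv \<phi>_closed \<phi>_dm \<phi>_rn)
  show "composable H (ginv H h0 \<cdot>\<^bsub>H\<^esub> \<phi> a) h1" "composable H (ginv H h0) (\<phi> a \<cdot>\<^bsub>H\<^esub> h1)"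
    using 1 2 H.mul_closed[OF 1] H.mul_closed[OF 2] H.rn_mul[OF 1] H.dm_mul[OF 2]
    by (simp_all add: composable_def)
qed

lemma proj_in_arr:
  assumes "(h0, a, h1) \<in> arr M"
  shows "cocyl_proj H \<phi> (h0, a, h1) \<in> arr H"
    "dm H (cocyl_proj H \<phi> (h0, a, h1)) = rn H h0"
    "rn H (cocyl_proj H \<phi> (h0, a, h1)) = rn H h1"
  using assms proj_composable[OF assms]
  by (simp_all add: proj_eq H.mul_closed H.dm_mul H.rn_mul H.dm_ginv arr_M)

lemma proj_identity:
  assumes "a \<in> arr G" "dm G a = a" "h \<in> arr H" "dm H h = \<phi> a"
  shows "cocyl_proj H \<phi> (h, a, h) = rn H h"
proof -
  have "rn H (ginv H h) = \<phi> a" using assms by (simp add: H.rn_ginv)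
  then have "ginv H h \<cdot>\<^bsub>H\<^esub> \<phi> a = ginv H h" using H.mul_rn_self[OF H.ginv_closed[OF assms(3)]] by simp
  then show ?thesis by (simp add: proj_eq rn_def)
qed

text \<open>The factor \<open>h1 h1\<^sup>-\<^sup>1\<close> in the middle of a product of two values cancels.\<close>

lemma proj_mul:
  assumes x: "(h0, a, h1) \<in> arr M" and y: "(h1, b, h2) \<in> arr M" and ab: "composable G a b"
  shows "cocyl_proj H \<phi> (h0, a \<cdot>\<^bsub>G\<^esub> b, h2) =
    cocyl_proj H \<phi> (h0, a, h1) \<cdot>\<^bsub>H\<^esub> cocyl_proj H \<phi> (h1, b, h2)"
proof -
  note cx = proj_composable[OF x] and cy = proj_composable[OF y]
  let ?u = "ginv H h0 \<cdot>\<^bsub>H\<^esub> \<phi> a" and ?v = "\<phi> b \<cdot>\<^bsub>H\<^esub> h2"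
  have h1: "h1 \<in> arr H" using x by (simp add: arr_M)
  have c\<phi>: "composable H (\<phi> a) (\<phi> b)" by (rule ordered_functor_composable[OF ord_functor_\<phi> ab])
  have v: "cocyl_proj H \<phi> (h1, b, h2) = ginv H h1 \<cdot>\<^bsub>H\<^esub> ?v"
    by (simp add: proj_eq H.mul_assoc[OF cy(1,2)])
  have c1: "composable H h1 (ginv H h1 \<cdot>\<^bsub>H\<^esub> ?v)"
    using cy(4) h1 by (simp add: composable_def H.mul_closed H.dm_mul H.dm_ginv)
  have "cocyl_proj H \<phi> (h0, a, h1) \<cdot>\<^bsub>H\<^esub> cocyl_proj H \<phi> (h1, b, h2)
      = ?u \<cdot>\<^bsub>H\<^esub> (h1 \<cdot>\<^bsub>H\<^esub> (ginv H h1 \<cdot>\<^bsub>H\<^esub> ?v))"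
    unfolding v by (simp add: proj_eq H.mul_assoc[OF cx(3) c1])
  also have "h1 \<cdot>\<^bsub>H\<^esub> (ginv H h1 \<cdot>\<^bsub>H\<^esub> ?v) = ?v"
    using H.ginv_mul_cancel[OF cy(4)] h1 by (simp add: H.ginv_ginv)
  also have "?u \<cdot>\<^bsub>H\<^esub> ?v = (?u \<cdot>\<^bsub>H\<^esub> \<phi> b) \<cdot>\<^bsub>H\<^esub> h2"
    using cx(1) cy(2) c\<phi> by (intro H.mul_assoc[symmetric])
      (auto simp: composable_def H.mul_closed H.rn_mul)
  also have "?u \<cdot>\<^bsub>H\<^esub> \<phi> b = ginv H h0 \<cdot>\<^bsub>H\<^esub> \<phi> (a \<cdot>\<^bsub>G\<^esub> b)"
    using cx(1) c\<phi> ab by (simp add: H.mul_assoc \<phi>_mul)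
  finally show ?thesis by (simp add: proj_eq)
qed

lemma ordered_functor_proj: "ordered_functor M H (cocyl_proj H \<phi>)"
  unfolding ordered_functor_def
proof (intro conjI allI ballI impI)
  fix x assume x: "x \<in> arr M"
  obtain h0 a h1 where x_eq: "x = (h0, a, h1)" by (cases x)
  have a: "a \<in> arr G" "h0 \<in> arr H" "h1 \<in> arr H" "dm H h0 = \<phi> (dm G a)" "dm H h1 = \<phi> (rn G a)"
    using x by (auto simp: x_eq arr_M)
  show "cocyl_proj H \<phi> x \<in> arr H" using x proj_in_arr by (simp add: x_eq)
  show "cocyl_proj H \<phi> (dm M x) = dm H (cocyl_proj H \<phi> x)"
    using x a by (simp add: x_eq proj_in_arr dm_M proj_identity G.dm_closed G.dm_dm)
  show "cocyl_proj H \<phi> (rn M x) = rn H (cocyl_proj H \<phi> x)"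
    using x a by (simp add: x_eq proj_in_arr rn_M proj_identity G.rn_closed G.dm_rn)
next
  fix x y assume "composable M x y"
  then show "cocyl_proj H \<phi> (x \<cdot>\<^bsub>M\<^esub> y) = cocyl_proj H \<phi> x \<cdot>\<^bsub>H\<^esub> cocyl_proj H \<phi> y"
    by (cases x; cases y) (auto simp: composable_M mul_M intro: proj_mul)
next
  fix x y assume *: "x \<in> arr M" "y \<in> arr M" "x \<preceq>\<^bsub>M\<^esub> y"
  obtain h0 a h1 k0 b k1 where xy: "x = (h0, a, h1)" "y = (k0, b, k1)" by (cases x; cases y)
  have m: "h0 \<in> arr H" "k0 \<in> arr H" "a \<in> arr G" "b \<in> arr G" using * by (auto simp: xy arr_M)
  have l: "h0 \<preceq>\<^bsub>H\<^esub> k0" "a \<preceq>\<^bsub>G\<^esub> b" "h1 \<preceq>\<^bsub>H\<^esub> k1" using * by (auto simp: xy leq_M)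
  show "cocyl_proj H \<phi> x \<preceq>\<^bsub>H\<^esub> cocyl_proj H \<phi> y"
    unfolding xy proj_eq
    using proj_composable *(1,2) m l unfolding xy by (intro H.OG2 H.OG1 \<phi>_mono) auto
qed

lemma proj_incl:
  assumes "g \<in> arr G"
  shows "cocyl_proj H \<phi> (cocyl_incl G \<phi> g) = \<phi> g"
  using assms H.dm_mul_self[OF \<phi>_closed[OF assms]] H.mul_rn_self[OF \<phi>_closed[OF assms]]
  by (simp add: cocyl_incl_def proj_eq \<phi>_dm \<phi>_rn H.ginv_dm \<phi>_closed)

end

section \<open>Lifting homotopies along the projection\<close>

text \<open>
  A homotopy is followed from its start \<open>I0\<close> up to either end of an arrow \<open>t\<close> of the interval;
  the required path is unique.  The range of \<open>t\<close> is reached as the domain of its inverse.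
\<close>

fun path_to_dm :: "interval \<Rightarrow> interval" where
  "path_to_dm I0 = I0"
| "path_to_dm Iota = I0"
| "path_to_dm I1 = Iota"
| "path_to_dm IotaInv = Iota"

abbreviation path_to_rn :: "interval \<Rightarrow> interval" where
  "path_to_rn t \<equiv> path_to_dm (interval_inv t)"

lemma arr_interval: "t \<in> arr interval_groupoid"
  by (simp add: interval_groupoid_def)

lemma mul_interval: "s \<cdot>\<^bsub>interval_groupoid\<^esub> t = interval_mul s t"
  by (simp add: interval_groupoid_def)

lemma ginv_interval: "ginv interval_groupoid t = interval_inv t"
  by (simp add: interval_groupoid_def)

lemma leq_interval: "s \<preceq>\<^bsub>interval_groupoid\<^esub> t \<longleftrightarrow> s = t"
  by (simp add: interval_groupoid_def)

lemma dm_interval: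
  "dm interval_groupoid t = (if t = I0 \<or> t = Iota then I0 else I1)"
  by (cases t) (simp_all add: dm_def mul_interval ginv_interval)

lemma rn_interval:
  "rn interval_groupoid t = (if t = I0 \<or> t = IotaInv then I0 else I1)"
  by (cases t) (simp_all add: rn_def mul_interval ginv_interval)

lemma composable_interval:
  "composable interval_groupoid s t \<longleftrightarrow> (s = I0 \<or> s = IotaInv) = (t = I0 \<or> t = Iota)"
  by (simp add: composable_def arr_interval dm_interval rn_interval)

lemmas interval_simps = arr_interval mul_interval ginv_interval leq_interval dm_interval
  rn_interval composable_interval

lemma groupoid_interval: "groupoid interval_groupoid"
proof
  fix g h k
  assume "composable interval_groupoid g h" "composable interval_groupoid h k"
  then show "g \<cdot>\<^bsub>interval_groupoid\<^esub> h \<cdot>\<^bsub>interval_groupoid\<^esub> k =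
      g \<cdot>\<^bsub>interval_groupoid\<^esub> (h \<cdot>\<^bsub>interval_groupoid\<^esub> k)"
    by (cases g; cases h; cases k; simp add: interval_simps)
next
  fix g h
  assume c: "composable interval_groupoid g h"
  show "dm interval_groupoid (g \<cdot>\<^bsub>interval_groupoid\<^esub> h) = dm interval_groupoid g"
    using c by (cases g; cases h; simp add: interval_simps)
  show "rn interval_groupoid (g \<cdot>\<^bsub>interval_groupoid\<^esub> h) = rn interval_groupoid h"
    using c by (cases g; cases h; simp add: interval_simps)
next
  fix g
  show "dm interval_groupoid g \<cdot>\<^bsub>interval_groupoid\<^esub> g = g"
    by (cases g; simp add: interval_simps)
  show "g \<cdot>\<^bsub>interval_groupoid\<^esub> rn interval_groupoid g = g"
    by (cases g; simp add: interval_simps)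
  show "dm interval_groupoid (ginv interval_groupoid g) = rn interval_groupoid g"
    by (cases g; simp add: interval_simps)
  show "rn interval_groupoid (ginv interval_groupoid g) = dm interval_groupoid g"
    by (cases g; simp add: interval_simps)
qed (simp_all add: interval_simps)

lemma dm_path: "dm interval_groupoid (path_to_dm t) = I0"
  by (cases t) (simp_all add: dm_interval)

lemma dm_prod: "dm (prod_groupoid A B) (a, b) = (dm A a, dm B b)"
  by (simp add: dm_def prod_groupoid_def)

lemma rn_prod: "rn (prod_groupoid A B) (a, b) = (rn A a, rn B b)"
  by (simp add: rn_def prod_groupoid_def)

lemma arr_prod: "(a, b) \<in> arr (prod_groupoid A B) \<longleftrightarrow> a \<in> arr A \<and> b \<in> arr B"
  by (simp add: prod_groupoid_def)

lemma composable_prod: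
  "composable (prod_groupoid A B) (a, b) (a', b') \<longleftrightarrow> composable A a a' \<and> composable B b b'"
  by (auto simp: composable_def arr_prod dm_prod rn_prod)

lemma mul_prod: "(a, b) \<cdot>\<^bsub>prod_groupoid A B\<^esub> (a', b') = (a \<cdot>\<^bsub>A\<^esub> a', b \<cdot>\<^bsub>B\<^esub> b')"
  by (simp add: prod_groupoid_def)

lemma ginv_prod: "ginv (prod_groupoid A B) (a, b) = (ginv A a, ginv B b)"
  by (simp add: prod_groupoid_def)

lemma leq_prod: "(a, b) \<preceq>\<^bsub>prod_groupoid A B\<^esub> (a', b') \<longleftrightarrow> a \<preceq>\<^bsub>A\<^esub> a' \<and> b \<preceq>\<^bsub>B\<^esub> b'"
  by (simp add: prod_groupoid_def)

lemmas prod_simps = dm_prod rn_prod arr_prod composable_prod mul_prod ginv_prod leq_prod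

lemma groupoid_prod:
  assumes "groupoid A" "groupoid B"
  shows "groupoid (prod_groupoid A B)"
proof -
  interpret A: groupoid A by fact
  interpret B: groupoid B by fact
  show ?thesis
  proof
  qed (auto simp: prod_simps A.dm_closed A.rn_closed A.dm_dm A.rn_dm A.dm_rn A.rn_rn A.mul_closed
        A.dm_mul A.rn_mul A.mul_assoc A.dm_mul_self A.mul_rn_self A.ginv_closed A.dm_ginv A.rn_ginv
        B.dm_closed B.rn_closed B.dm_dm B.rn_dm B.dm_rn B.rn_rn B.mul_closed
        B.dm_mul B.rn_mul B.mul_assoc B.dm_mul_self B.mul_rn_self B.ginv_closed B.dm_ginv B.rn_ginv)
qed

locale lifting_problem = cocylinder G H \<phi> + A: ordered_groupoid A
  for G :: "'a ord_groupoid" and H :: "'b ord_groupoid" and \<phi> :: "'a \<Rightarrow> 'b"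
    and A :: "'c ord_groupoid" +
  fixes f :: "'c \<Rightarrow> 'b \<times> 'a \<times> 'b" and F :: "'c \<times> interval \<Rightarrow> 'b"
  assumes f: "ordered_functor A M f"
    and F: "ordered_functor (prod_groupoid A interval_groupoid) H F"
    and start: "a \<in> arr A \<Longrightarrow> cocyl_proj H \<phi> (f a) = F (a, I0)"
begin

definition start_leg :: "'c \<Rightarrow> 'b" where "start_leg a = fst (f a)"
definition base :: "'c \<Rightarrow> 'a" where "base a = fst (snd (f a))"
definition end_leg :: "'c \<Rightarrow> 'b" where "end_leg a = snd (snd (f a))"

text \<open>
  For an identity \<open>e\<close> of \<open>A\<close>, the object \<open>f e\<close> carries an arrow of \<open>H\<close> that ends where the path
  \<open>F (e, -)\<close> starts.  The lift keeps the component in \<open>G\<close> and extends that arrow along the path,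
  up to the domain of \<open>t\<close>.
\<close>

definition leg :: "'c \<Rightarrow> interval \<Rightarrow> 'b" where
  "leg e t = start_leg e \<cdot>\<^bsub>H\<^esub> F (e, path_to_dm t)"

definition lift :: "'c \<times> interval \<Rightarrow> 'b \<times> 'a \<times> 'b" where
  "lift = (\<lambda>(a, t). (leg (dm A a) t, base a, leg (rn A a) (interval_inv t)))"

lemma f_eq: "f a = (start_leg a, base a, end_leg a)"
  by (simp add: start_leg_def base_def end_leg_def)

lemma f_arr:
  assumes "a \<in> arr A"
  shows "(start_leg a, base a, end_leg a) \<in> arr M"
  using ordered_functorD(1)[OF f assms] by (simp add: f_eq)

lemma f_dm:
  assumes "a \<in> arr A"
  shows "start_leg (dm A a) = start_leg a" "base (dm A a) = dm G (base a)"
    "end_leg (dm A a) = start_leg a"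
  using ordered_functorD(2)[OF f assms] by (auto simp: f_eq dm_M)

lemma f_rn:
  assumes "a \<in> arr A"
  shows "start_leg (rn A a) = end_leg a" "base (rn A a) = rn G (base a)"
    "end_leg (rn A a) = end_leg a"
  using ordered_functorD(3)[OF f assms] by (auto simp: f_eq rn_M)

lemma f_mono:
  assumes "a \<in> arr A" "b \<in> arr A" "a \<preceq>\<^bsub>A\<^esub> b"
  shows "start_leg a \<preceq>\<^bsub>H\<^esub> start_leg b" "base a \<preceq>\<^bsub>G\<^esub> base b"
  using ordered_functorD(5)[OF f assms] by (auto simp: f_eq leq_M)

lemma F_closed: "a \<in> arr A \<Longrightarrow> F (a, t) \<in> arr H"
  using ordered_functorD(1)[OF F, of "(a, t)"] by (simp add: arr_prod arr_interval)

lemma F_dm: "a \<in> arr A \<Longrightarrow> dm H (F (a, t)) = F (dm A a, dm interval_groupoid t)"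
  using ordered_functorD(2)[OF F, of "(a, t)"] by (simp add: arr_prod arr_interval dm_prod)

lemma F_ginv: "a \<in> arr A \<Longrightarrow> F (ginv A a, interval_inv t) = ginv H (F (a, t))"
  using ordered_functor_ginv[OF groupoid_prod[OF A.groupoid_axioms groupoid_interval]
      H.groupoid_axioms F, of "(a, t)"]
  by (simp add: arr_prod arr_interval ginv_prod ginv_interval)

lemma F_mul:
  assumes "composable A a b" "composable interval_groupoid s t"
  shows "F (a, s) \<cdot>\<^bsub>H\<^esub> F (b, t) = F (a \<cdot>\<^bsub>A\<^esub> b, interval_mul s t)"
  using ordered_functorD(4)[OF F, of "(a, s)" "(b, t)"] assms
  by (simp add: composable_prod mul_prod mul_interval)

lemma F_mono: "\<lbrakk>a \<in> arr A; b \<in> arr A; a \<preceq>\<^bsub>A\<^esub> b\<rbrakk> \<Longrightarrow> F (a, t) \<preceq>\<^bsub>H\<^esub> F (b, t)"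
  using ordered_functorD(5)[OF F, of "(a, t)" "(b, t)"]
  by (simp add: arr_prod arr_interval leq_prod leq_interval)

text \<open>
  The last equation makes the extension composable: \<open>f e\<close> is an identity, so it projects to the
  identity at the end of its leg, and it projects to \<open>F (e, I0)\<close> because \<open>F\<close> starts at \<open>f\<close>.
\<close>

lemma identity_leg:
  assumes "e \<in> identities A"
  shows "base e \<in> arr G" "dm G (base e) = base e" "start_leg e \<in> arr H"
    "dm H (start_leg e) = \<phi> (base e)" "F (e, I0) = rn H (start_leg e)"
proof -
  have e: "e \<in> arr A" "dm A e = e" using assms by (auto simp: identities_def)
  show b: "base e \<in> arr G" "dm G (base e) = base e" "start_leg e \<in> arr H"
    "dm H (start_leg e) = \<phi> (base e)"
    using f_arr[OF e(1)] f_dm[OF e(1)] e(2) by (auto simp: arr_M)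
  have "f e = (start_leg e, base e, start_leg e)" using f_eq f_dm(3)[OF e(1)] e(2) by simp
  then show "F (e, I0) = rn H (start_leg e)" using start[OF e(1)] proj_identity b by simp
qed

lemma leg_composable:
  assumes "e \<in> identities A"
  shows "composable H (start_leg e) (F (e, path_to_dm t))"
proof -
  have e: "e \<in> arr A" "dm A e = e" using assms by (auto simp: identities_def)
  show ?thesis
    using identity_leg[OF assms] F_dm[OF e(1), of "path_to_dm t"]
    by (simp add: composable_def F_closed e dm_path)
qed

lemma leg_arr:
  assumes "e \<in> identities A"
  shows "leg e t \<in> arr H" "dm H (leg e t) = \<phi> (base e)"
  using leg_composable[OF assms, of t] identity_leg[OF assms]
  by (simp_all add: leg_def H.mul_closed H.dm_mul)

lemma leg_I0:
  assumes "e \<in> identities A"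
  shows "leg e I0 = start_leg e"
  using identity_leg[OF assms] by (simp add: leg_def H.mul_rn_self)

lemma leg_mono:
  assumes "e \<in> identities A" "e' \<in> identities A" "e \<preceq>\<^bsub>A\<^esub> e'"
  shows "leg e t \<preceq>\<^bsub>H\<^esub> leg e' t"
  unfolding leg_def using assms
  by (intro H.OG2 leg_composable F_mono f_mono) (auto simp: identities_def)

lemma lift_arr:
  assumes "a \<in> arr A"
  shows "lift (a, t) \<in> arr M"
  using f_arr[OF assms] leg_arr[OF A.dm_in_identities[OF assms]] leg_arr[OF A.rn_in_identities[OF assms]]
    f_dm[OF assms] f_rn[OF assms]
  by (simp add: lift_def arr_M)

lemma lift_ordered_functor: "ordered_functor (prod_groupoid A interval_groupoid) M lift"
  unfolding ordered_functor_def
proof (intro conjI allI ballI impI)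
  fix x assume x: "x \<in> arr (prod_groupoid A interval_groupoid)"
  obtain a t where x_eq: "x = (a, t)" by (cases x)
  have a: "a \<in> arr A" using x by (simp add: x_eq arr_prod)
  show "lift x \<in> arr M" using lift_arr a by (simp add: x_eq)
  show "lift (dm (prod_groupoid A interval_groupoid) x) = dm M (lift x)"
    using a by (cases t) (simp_all add: x_eq dm_prod lift_def dm_M A.dm_dm A.rn_dm f_dm
        dm_interval leg_def)
  show "lift (rn (prod_groupoid A interval_groupoid) x) = rn M (lift x)"
    using a by (cases t) (simp_all add: x_eq rn_prod lift_def rn_M A.dm_rn A.rn_rn f_rn
        rn_interval leg_def)
next
  fix x y assume c: "composable (prod_groupoid A interval_groupoid) x y"
  obtain a s b t where xy: "x = (a, s)" "y = (b, t)" by (cases x; cases y)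
  have ab: "composable A a b" and st: "rn interval_groupoid s = dm interval_groupoid t"
    using c unfolding xy composable_prod by (auto simp: composable_def)
  have paths: "path_to_dm (interval_mul s t) = path_to_dm s"
      "path_to_rn (interval_mul s t) = path_to_rn t"
    using st by (cases s; cases t; simp add: dm_interval rn_interval)+
  have "base (a \<cdot>\<^bsub>A\<^esub> b) = base a \<cdot>\<^bsub>G\<^esub> base b"
    using ordered_functorD(4)[OF f ab] by (simp add: f_eq mul_M)
  then show "lift (x \<cdot>\<^bsub>prod_groupoid A interval_groupoid\<^esub> y) = lift x \<cdot>\<^bsub>M\<^esub> lift y"
    using ab paths by (simp add: xy mul_prod mul_interval lift_def mul_M A.dm_mul A.rn_mul leg_def)
next
  fix x y
  assume "x \<in> arr (prod_groupoid A interval_groupoid)" "y \<in> arr (prod_groupoid A interval_groupoid)"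
    "x \<preceq>\<^bsub>prod_groupoid A interval_groupoid\<^esub> y"
  moreover obtain a s b t where xy: "x = (a, s)" "y = (b, t)" by (cases x; cases y)
  ultimately have ab: "a \<in> arr A" "b \<in> arr A" "a \<preceq>\<^bsub>A\<^esub> b" "s = t"
    by (auto simp: arr_prod leq_prod leq_interval)
  then show "lift x \<preceq>\<^bsub>M\<^esub> lift y"
    by (auto simp: xy lift_def leq_M intro: leg_mono f_mono A.dm_mono A.rn_mono
        A.dm_in_identities A.rn_in_identities)
qed

lemma lift_start:
  assumes "a \<in> arr A"
  shows "lift (a, I0) = f a"
  using assms by (simp add: lift_def leg_I0 A.dm_in_identities A.rn_in_identities f_dm f_rn f_eq)

text \<open>
  Write \<open>s\<close> and \<open>r\<close> for the paths from \<open>I0\<close> to the domain and the range of \<open>t\<close>.  Inverting the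
  extended left leg turns the projection of the lift into
  \<open>F (a\<^bold>d, s)\<^sup>-\<^sup>1 F (a, I0) F (a\<^bold>r, r)\<close>, the middle factor being the projection of \<open>f a\<close>.
  Functoriality of \<open>F\<close> gives \<open>F (a, s\<^sup>-\<^sup>1 r)\<close>, and \<open>s\<^sup>-\<^sup>1 r = t\<close>.
\<close>

lemma proj_lift:
  assumes a: "a \<in> arr A"
  shows "cocyl_proj H \<phi> (lift (a, t)) = F (a, t)"
proof -
  let ?s = "F (dm A a, path_to_dm t)" and ?r = "F (rn A a, path_to_rn t)"
  let ?h0 = "start_leg a" and ?h1 = "end_leg a"
  let ?x = "\<phi> (base a)"
  note da = A.dm_in_identities[OF a] and ra = A.rn_in_identities[OF a]
  have c0: "composable H ?h0 ?s" using leg_composable[OF da] f_dm[OF a] by simp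
  have c1: "composable H ?h1 ?r" using leg_composable[OF ra] f_rn[OF a] by simp
  note cf = proj_composable[OF f_arr[OF a]]
  have h0: "?h0 \<in> arr H" "?s \<in> arr H" "rn H ?h0 = dm H ?s" using c0 by (auto simp: composable_def)
  have cs0: "composable H (ginv H ?s) (ginv H ?h0)"
    using h0 by (simp add: composable_def H.ginv_closed H.dm_ginv H.rn_ginv)
  have s: "ginv H ?s = F (dm A a, interval_inv (path_to_dm t))"
    using F_ginv[of "dm A a" "path_to_dm t"] a by (simp add: A.dm_closed A.ginv_dm)
  have I: "composable interval_groupoid (interval_inv (path_to_dm t)) I0"
      "composable interval_groupoid (interval_inv (path_to_dm t)) (path_to_rn t)"
    by (cases t; simp add: composable_interval)+
  have J: "interval_mul (interval_inv (path_to_dm t)) I0 = interval_inv (path_to_dm t)"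
      "interval_mul (interval_inv (path_to_dm t)) (path_to_rn t) = t"
    by (cases t; simp)+
  have ca: "composable A (dm A a) a" "composable A a (rn A a)"
    using a by (simp_all add: composable_def A.dm_closed A.rn_closed A.rn_dm A.dm_rn)
  have fa: "F (a, I0) = ginv H ?h0 \<cdot>\<^bsub>H\<^esub> ?x \<cdot>\<^bsub>H\<^esub> ?h1"
    using start[OF a] by (simp add: f_eq proj_eq)
  have sx: "composable H (ginv H ?s) (ginv H ?h0 \<cdot>\<^bsub>H\<^esub> ?x)"
    using cs0 cf(1) by (simp add: composable_def H.mul_closed H.dm_mul)
  have sxh: "composable H (ginv H ?s \<cdot>\<^bsub>H\<^esub> (ginv H ?h0 \<cdot>\<^bsub>H\<^esub> ?x)) ?h1"
    using sx cf(3) by (simp add: composable_def H.mul_closed H.rn_mul)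
  have "cocyl_proj H \<phi> (lift (a, t)) = ginv H (?h0 \<cdot>\<^bsub>H\<^esub> ?s) \<cdot>\<^bsub>H\<^esub> ?x \<cdot>\<^bsub>H\<^esub> (?h1 \<cdot>\<^bsub>H\<^esub> ?r)"
    using a by (simp add: lift_def proj_eq leg_def f_dm f_rn)
  also have "\<dots> = (ginv H ?s \<cdot>\<^bsub>H\<^esub> (ginv H ?h0 \<cdot>\<^bsub>H\<^esub> ?x)) \<cdot>\<^bsub>H\<^esub> (?h1 \<cdot>\<^bsub>H\<^esub> ?r)"
    by (simp add: H.ginv_mul[OF c0] H.mul_assoc[OF cs0 cf(1)])
  also have "\<dots> = (ginv H ?s \<cdot>\<^bsub>H\<^esub> (ginv H ?h0 \<cdot>\<^bsub>H\<^esub> ?x)) \<cdot>\<^bsub>H\<^esub> ?h1 \<cdot>\<^bsub>H\<^esub> ?r"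
    by (rule H.mul_assoc[OF sxh c1, symmetric])
  also have "(ginv H ?s \<cdot>\<^bsub>H\<^esub> (ginv H ?h0 \<cdot>\<^bsub>H\<^esub> ?x)) \<cdot>\<^bsub>H\<^esub> ?h1 = ginv H ?s \<cdot>\<^bsub>H\<^esub> F (a, I0)"
    unfolding fa by (rule H.mul_assoc[OF sx cf(3)])
  also have "\<dots> = F (a, interval_inv (path_to_dm t))"
    unfolding s F_mul[OF ca(1) I(1)] using a J by (simp add: A.dm_mul_self)
  also have "\<dots> \<cdot>\<^bsub>H\<^esub> ?r = F (a, t)"
    unfolding F_mul[OF ca(2) I(2)] using a J by (simp add: A.mul_rn_self)
  finally show ?thesis .
qed

end

lemma (in cocylinder) strong_fibration_proj: "strong_fibration TYPE('c) M H (cocyl_proj H \<phi>)"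
  unfolding strong_fibration_def
proof (intro conjI allI impI ordered_groupoid_M ordered_functor_proj H.ordered_groupoid_axioms)
  fix A :: "'c ord_groupoid" and f :: "'c \<Rightarrow> 'b \<times> 'a \<times> 'b" and F :: "'c \<times> interval \<Rightarrow> 'b"
  assume *: "ordered_groupoid A \<and> ordered_functor A M f \<and>
    ordered_functor (prod_groupoid A interval_groupoid) H F \<and>
    (\<forall>a\<in>arr A. cocyl_proj H \<phi> (f a) = F (a, I0))"
  interpret A: ordered_groupoid A using * by blast
  interpret L: lifting_problem G H \<phi> A f F by unfold_locales (use * in auto)
  show "\<exists>F'. ordered_functor (prod_groupoid A interval_groupoid) M F' \<and>
      (\<forall>a\<in>arr A. F' (a, I0) = f a) \<and>
      (\<forall>x\<in>arr (prod_groupoid A interval_groupoid). cocyl_proj H \<phi> (F' x) = F x)"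
    using L.lift_ordered_functor L.lift_start L.proj_lift
    by (intro exI[of _ L.lift]) (auto simp: arr_prod)
qed

section \<open>The factorization\<close>

theorem theorem5p2:
  fixes G :: "'a ord_groupoid" and H :: "'b ord_groupoid" and \<phi> :: "'a \<Rightarrow> 'b"
  assumes "ordered_groupoid G" and "ordered_groupoid H" and "ordered_functor G H \<phi>"
  shows "ordered_groupoid (mapping_cocylinder G H \<phi>) \<and>
    ordered_functor G (mapping_cocylinder G H \<phi>) (cocyl_incl G \<phi>) \<and>
    ordered_functor (mapping_cocylinder G H \<phi>) H (cocyl_proj H \<phi>) \<and>
    (\<forall>g\<in>arr G. \<phi> g = cocyl_proj H \<phi> (cocyl_incl G \<phi> g)) \<and>
    enlargement (cocyl_incl G \<phi> ` arr G) (mapping_cocylinder G H \<phi>) \<and>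
    strong_fibration TYPE('c) (mapping_cocylinder G H \<phi>) H (cocyl_proj H \<phi>)"
proof -
  interpret G: ordered_groupoid G by fact
  interpret H: ordered_groupoid H by fact
  interpret cocylinder G H \<phi> by unfold_locales fact
  show ?thesis
    using ordered_groupoid_M ordered_functor_incl ordered_functor_proj proj_incl enlargement_M
      strong_fibration_proj by auto
qed

end
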